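(* If $p$ is an odd prime and $n=p-2$, then the polynomial $p_n(x)$ is irreducible over $\mathbb{Q}$.
   Context: The polynomials $p_n(z)\in\mathbb{Z}[z]$ ($n\ge 0$) are defined by the generating function (formal power series in $t$) $$\frac{1}{\left(1-(z+1)^2t\right)^2\left(1-(z-1)^2t\right)}=\sum_{n=0}^\infty p_n(z)t^n .$$ *)

theory Defs
  imports "HOL-Computational_Algebra.Computational_Algebra"
begin

text \<open>
  Formal power series in \<open>t\<close> (\<open>fps_X\<close>) over the ring of integer polynomials in
  \<open>z\<close> (\<open>[:0, 1:]\<close>, so \<open>[:1, 1:]\<close> is \<open>z + 1\<close> and \<open>[:-1, 1:]\<close> is \<open>z - 1\<close>).
\<close>

definition gf_denom :: "int poly fps" where
  "gf_denom = (1 - fps_const ([:1, 1:] ^ 2) * fps_X) ^ 2 * (1 - fps_const ([:-1, 1:] ^ 2) * fps_X)"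

text \<open>
  The coefficient ring is not a field, so the reciprocal is taken with
  \<open>fps_right_inverse\<close>, whose second argument is the inverse of the constant
  coefficient \<open>1\<close>. The lemma \<open>gf_unique\<close> below shows that it is the reciprocal.
\<close>

definition gf :: "int poly fps" where
  "gf = fps_right_inverse gf_denom 1"

definition p_poly :: "nat \<Rightarrow> int poly" where
  "p_poly n = fps_nth gf n"

lemma gf_denom_nth_0: "fps_nth gf_denom 0 = 1"
  by (simp add: gf_denom_def power2_eq_square)

lemma gf_denom_mult_gf: "gf_denom * gf = 1"
  unfolding gf_def by (rule fps_right_inverse) (simp add: gf_denom_nth_0)

lemma gf_unique: "gf_denom * F = 1 \<longleftrightarrow> F = gf"
proof
  assume F: "gf_denom * F = 1"
  have "F = (gf_denom * gf) * F" by (simp add: gf_denom_mult_gf)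
  also have "\<dots> = (gf_denom * F) * gf" by (simp add: mult_ac)
  finally show "F = gf" by (simp add: F)
qed (simp add: gf_denom_mult_gf)

end

theory Submission
  imports Defs
begin

text \<open>
  With \<open>a = (z + 1)\<^sup>2\<close> and \<open>b = (z - 1)\<^sup>2\<close> we have \<open>p\<^sub>n = \<Sum>k\<le>n. (k + 1) a\<^sup>k b\<^sup>n\<^sup>-\<^sup>k\<close>, so that
  \<open>16 z\<^sup>2 p\<^sub>n = 4 (n + 2) z a\<^sup>n\<^sup>+\<^sup>1 - (a\<^sup>n\<^sup>+\<^sup>2 - b\<^sup>n\<^sup>+\<^sup>2)\<close>. For \<open>n = p - 2\<close> this makes \<open>p\<^sub>n\<close> a nonzero multiple
  of \<open>z\<^sup>n\<close> modulo \<open>p\<close>, whereas its constant and leading coefficients both equal \<open>p (p - 1) / 2\<close> and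
  its degree is \<open>2 n\<close>. The \<open>p\<close>-adic Newton polygon thus has two segments of length \<open>n\<close> and slopes
  \<open>\<plusminus>1 / n\<close>, so a proper factor over the rationals must have degree exactly \<open>n\<close>. As \<open>n\<close> is odd, such a
  factor has a real root, but \<open>p\<^sub>n\<close> is a sum of nonnegative terms without a common real zero.
\<close>

section \<open>Integer polynomials over larger rings\<close>

lemma map_poly_of_int_mult:
  "map_poly (of_int :: int \<Rightarrow> 'a :: {comm_ring_1, ring_char_0}) (f * g) = map_poly of_int f * map_poly of_int g"
  by (rule poly_eqI) (simp add: coeff_map_poly coeff_mult)

lemma map_poly_of_int_add:
  "map_poly (of_int :: int \<Rightarrow> 'a :: {comm_ring_1, ring_char_0}) (f + g) = map_poly of_int f + map_poly of_int g"
  by (rule poly_eqI) (simp add: coeff_map_poly)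

lemma map_poly_of_int_smult:
  "map_poly (of_int :: int \<Rightarrow> 'a :: {comm_ring_1, ring_char_0}) (smult c f) = smult (of_int c) (map_poly of_int f)"
  by (rule poly_eqI) (simp add: coeff_map_poly)

lemma map_poly_of_int_sum:
  "map_poly (of_int :: int \<Rightarrow> 'a :: {comm_ring_1, ring_char_0}) (sum f A) = (\<Sum>x\<in>A. map_poly of_int (f x))"
  by (induction A rule: infinite_finite_induct) (simp_all add: map_poly_of_int_add)

lemma map_poly_of_int_power:
  "map_poly (of_int :: int \<Rightarrow> 'a :: {comm_ring_1, ring_char_0}) (f ^ k) = map_poly of_int f ^ k"
  by (induction k) (simp_all add: map_poly_of_int_mult)

lemma map_poly_of_int_inject:
  "map_poly (of_int :: int \<Rightarrow> 'a :: {comm_ring_1, ring_char_0}) f = map_poly of_int g \<longleftrightarrow> f = g"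
  by (simp add: poly_eq_iff coeff_map_poly)

lemma degree_map_poly_of_int:
  "degree (map_poly (of_int :: int \<Rightarrow> 'a :: {comm_ring_1, ring_char_0}) f) = degree f"
  by (rule degree_map_poly) simp

lemma rat_poly_clear_denominators:
  fixes f :: "rat poly"
  obtains d :: int and F :: "int poly" where "d > 0" "smult (of_int d) f = map_poly of_int F"
proof -
  have "\<exists>d F. d > 0 \<and> smult (of_int d) f = map_poly of_int F"
  proof (induction f)
    case 0
    show ?case by (intro exI[of _ 1] exI[of _ 0]) simp
  next
    case (pCons a g)
    then obtain d F where d: "d > 0" "smult (of_int d) g = map_poly of_int F" by blast
    obtain r s where a: "a = of_int r / of_int s" "s > 0"
      by (metis Fract_of_int_quotient Rat_cases)
    have "smult (of_int (s * d)) (pCons a g) = map_poly of_int (pCons (d * r) (smult s F))"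
    proof -
      have "smult (of_int (s * d)) g = smult (of_int s) (map_poly of_int F)"
        by (simp flip: d(2))
      also have "\<dots> = map_poly of_int (smult s F)"
        by (simp only: map_poly_of_int_smult)
      finally show ?thesis using a by (simp add: map_poly_pCons)
    qed
    with a d show ?case by (intro exI[of _ "s * d"]) (auto intro!: mult_pos_pos)
  qed
  thus ?thesis using that by blast
qed

text \<open>Gauss's lemma: primitive parts are multiplicative, so they remove the constants
  introduced by clearing denominators. The content of \<open>P\<close> is then returned to the first
  factor.\<close>

lemma int_poly_factor_of_rat_factor:
  fixes P :: "int poly" and f g :: "rat poly"
  assumes P: "map_poly of_int P = f * g" and "P \<noteq> 0"
  obtains F G where "P = F * G" "degree F = degree f" "degree G = degree g"
proof -
  obtain d F where d: "d > 0" "smult (of_int d) f = map_poly of_int F"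
    by (rule rat_poly_clear_denominators)
  obtain e G where e: "e > 0" "smult (of_int e) g = map_poly of_int G"
    by (rule rat_poly_clear_denominators)
  have "map_poly rat_of_int (smult (d * e) P) = map_poly of_int (F * G)"
    by (simp add: map_poly_of_int_smult P map_poly_of_int_mult mult_ac flip: d(2) e(2))
  hence "smult (d * e) P = F * G" by (simp only: map_poly_of_int_inject)
  hence "primitive_part (smult (d * e) P) = primitive_part F * primitive_part G"
    by (simp only: primitive_part_mult)
  moreover have "unit_factor (d * e) = 1" using d e by (simp add: sgn_mult)
  ultimately have "primitive_part P = primitive_part F * primitive_part G"
    by (simp add: primitive_part_smult)
  hence "P = smult (content P) (primitive_part F) * primitive_part G"
    by (metis content_times_primitive_part mult_smult_left)
  moreover have "degree (map_poly rat_of_int F) = degree f" "degree (map_poly rat_of_int G) = degree g"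
    using d e by (simp_all flip: d(2) e(2))
  ultimately show ?thesis
    using that[of "smult (content P) (primitive_part F)" "primitive_part G"] \<open>P \<noteq> 0\<close>
    by (simp add: degree_map_poly_of_int)
qed

lemma odd_degree_real_root:
  fixes q :: "real poly"
  assumes "odd (degree q)"
  shows "\<exists>x. poly q x = 0"
proof -
  have root: "\<exists>x. poly r x = 0" if r: "odd (degree r)" "lead_coeff r > 0" for r :: "real poly"
  proof -
    \<comment> \<open>\<open>s\<close> is \<open>- r(-x)\<close>, which in odd degree has the same
      leading coefficient as \<open>r\<close>; growth at plus infinity thus settles both
      signs.\<close>
    define s where "s = - pcompose r [:0, -1:]"
    have "lead_coeff s > 0"
      using r by (simp add: s_def lead_coeff_comp)
    then obtain b where b: "\<And>x. x \<ge> b \<Longrightarrow> poly s x > 0"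
      by (meson order_less_le_trans poly_pinfty_gt_lc)
    obtain c where c: "\<And>x. x \<ge> c \<Longrightarrow> poly r x > 0"
      using r by (meson order_less_le_trans poly_pinfty_gt_lc)
    define m where "m = max 1 (max b c)"
    have "poly r (- m) < 0" "poly r m > 0"
      using b[of m] c[of m] by (simp_all add: m_def s_def poly_pcompose)
    moreover have "- m < m" by (simp add: m_def)
    ultimately show ?thesis using poly_IVT_pos by blast
  qed
  have "lead_coeff q \<noteq> 0" using assms by auto
  then consider "lead_coeff q > 0" | "lead_coeff (- q) > 0" by force
  thus ?thesis
    using root[of q] root[of "- q"] assms by cases auto
qed

section \<open>Factors of a polynomial that is a monomial modulo a prime\<close>

text \<open>Modulo \<open>q\<close> the constant term of \<open>F\<close> is invertible, so
  multiplying by \<open>F\<close> does not change the order of vanishing at 0.\<close>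

lemma coeff_dvd_of_mult:
  fixes F G :: "int poly"
  assumes q: "prime q" and F: "\<not> q dvd coeff F 0" and FG: "\<And>k. k < n \<Longrightarrow> q dvd coeff (F * G) k"
  shows "k < n \<Longrightarrow> q dvd coeff G k"
    and "q dvd coeff G n \<longleftrightarrow> q dvd coeff (F * G) n"
proof -
  have step: "q dvd coeff G k \<longleftrightarrow> q dvd coeff (F * G) k" if "\<And>i. i < k \<Longrightarrow> q dvd coeff G i" for k
  proof -
    have "coeff (F * G) k = coeff F 0 * coeff G k + (\<Sum>i<k. coeff F (k - i) * coeff G i)"
      using coeff_mult[of G F k] by (simp add: lessThan_Suc_atMost[symmetric] mult.commute)
    moreover have "q dvd (\<Sum>i<k. coeff F (k - i) * coeff G i)"
      using that by (intro dvd_sum) auto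
    ultimately have "q dvd coeff (F * G) k \<longleftrightarrow> q dvd coeff F 0 * coeff G k"
      by (simp add: dvd_add_left_iff)
    thus ?thesis using q F by (simp add: prime_dvd_mult_iff)
  qed
  have low: "q dvd coeff G k" if "k < n" for k
    using that
  proof (induction k rule: less_induct)
    case (less k)
    thus ?case using step[of k] FG[of k] by auto
  qed
  show "k < n \<Longrightarrow> q dvd coeff G k" by (rule low)
  show "q dvd coeff G n \<longleftrightarrow> q dvd coeff (F * G) n" using step low by blast
qed

lemma degree_ge_of_mult:
  fixes F G :: "int poly"
  assumes "prime q" "\<not> q dvd coeff F 0" "\<And>k. k < n \<Longrightarrow> q dvd coeff (F * G) k" "\<not> q dvd coeff (F * G) n"
  shows "n \<le> degree G"
proof (rule le_degree)
  show "coeff G n \<noteq> 0" using coeff_dvd_of_mult(2)[OF assms(1-3)] assms(4) by force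
qed

text \<open>Modulo \<open>q\<close> the factors of a monomial are monomials, so \<open>F\<close>
  reduces to a constant and \<open>G\<close> to a multiple of \<open>x^n\<close>. Reversing the
  coefficients gives the bound from the other end.\<close>

lemma degree_factor_if_coeff_0_not_dvd:
  fixes F G :: "int poly"
  assumes q: "prime q" and deg: "degree (F * G) = 2 * n"
    and dvd: "\<And>k. k \<noteq> n \<Longrightarrow> q dvd coeff (F * G) k" and ndvd: "\<not> q dvd coeff (F * G) n"
    and lc: "\<not> q ^ 2 dvd lead_coeff (F * G)"
    and F: "degree F > 0" "\<not> q dvd coeff F 0"
  shows "degree F = n"
proof -
  have "F * G \<noteq> 0" using ndvd by auto
  hence sum: "degree F + degree G = 2 * n"
    using deg by (metis degree_mult_eq mult_eq_0_iff)
  have G: "n \<le> degree G" by (rule degree_ge_of_mult[OF q F(2) dvd ndvd]) auto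
  \<comment> \<open>The product has degree \<open>2 * n\<close>, so reversal fixes position
    \<open>n\<close> and preserves the divisibility pattern.\<close>
  have R: "coeff (reflect_poly F * reflect_poly G) k = coeff (F * G) (2 * n - k)" if "k \<le> n" for k
    using that by (simp add: coeff_reflect_poly deg flip: reflect_poly_mult)
  have Rdvd: "q dvd coeff (reflect_poly F * reflect_poly G) k" if "k < n" for k
    using that R[of k] dvd[of "2 * n - k"] by simp
  have Rndvd: "\<not> q dvd coeff (reflect_poly F * reflect_poly G) n"
    using R[of n] ndvd by simp
  have "\<not> q dvd lead_coeff F \<or> \<not> q dvd lead_coeff G"
    using lc by (auto simp: lead_coeff_mult power2_eq_square intro: mult_dvd_mono)
  thus ?thesis
  proof
    assume "\<not> q dvd lead_coeff G"
    hence "n \<le> degree (reflect_poly F)"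
      using Rdvd Rndvd by (intro degree_ge_of_mult[OF q, of "reflect_poly G"]) (simp_all add: mult.commute)
    hence "n \<le> degree F" using degree_reflect_poly_le le_trans by blast
    with G sum show ?thesis by simp
  next
    assume lF: "\<not> q dvd lead_coeff F"
    \<comment> \<open>This case is contradictory: reversal moves \<open>coeff G n\<close> to
      position \<open>k\<close>, and \<open>k < n\<close> because \<open>F\<close> is not constant,
      so \<open>q\<close> would divide it.\<close>
    define k where "k = degree G - n"
    have "k < n" using sum F(1) by (simp add: k_def)
    moreover have "\<not> q dvd coeff (reflect_poly F) 0" using lF by simp
    ultimately have "q dvd coeff (reflect_poly G) k"
      using coeff_dvd_of_mult(1)[OF q _ Rdvd] by blast
    hence "q dvd coeff G n" using G by (simp add: coeff_reflect_poly k_def split: if_splits)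
    thus ?thesis using coeff_dvd_of_mult(2)[OF q F(2), of n G] dvd ndvd by simp
  qed
qed

lemma degree_factor:
  fixes F G :: "int poly"
  assumes q: "prime q" and deg: "degree (F * G) = 2 * n"
    and dvd: "\<And>k. k \<noteq> n \<Longrightarrow> q dvd coeff (F * G) k" and ndvd: "\<not> q dvd coeff (F * G) n"
    and ends: "\<not> q ^ 2 dvd coeff (F * G) 0" "\<not> q ^ 2 dvd lead_coeff (F * G)"
    and FG: "degree F > 0" "degree G > 0"
  shows "degree F = n"
proof -
  \<comment> \<open>As in Eisenstein's criterion, \<open>q\<close> cannot divide both constant
    terms; if it misses that of \<open>G\<close>, the degree of \<open>F\<close> is the complement
    in \<open>2 * n\<close>.\<close>
  have "\<not> q dvd coeff F 0 \<or> \<not> q dvd coeff G 0"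
    using ends(1) by (auto simp: coeff_mult power2_eq_square intro: mult_dvd_mono)
  thus ?thesis
  proof
    assume "\<not> q dvd coeff F 0"
    thus ?thesis using degree_factor_if_coeff_0_not_dvd[of q F G n] assms by blast
  next
    assume "\<not> q dvd coeff G 0"
    hence "degree G = n" using degree_factor_if_coeff_0_not_dvd[of q G F n] assms by (simp add: mult.commute)
    moreover have "degree (F * G) = degree F + degree G"
      using FG by (intro degree_mult_eq) auto
    ultimately show ?thesis using deg by simp
  qed
qed

section \<open>The polynomials \<open>p_poly n\<close>\<close>

lemma fps_geometric_mult:
  fixes a :: "'a :: comm_ring_1"
  shows "(1 - fps_const a * fps_X) * Abs_fps (\<lambda>n. a ^ n) = 1"
proof (rule fps_ext)
  fix n
  show "fps_nth ((1 - fps_const a * fps_X) * Abs_fps (\<lambda>n. a ^ n)) n = fps_nth 1 n"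
    by (cases n) (simp_all add: algebra_simps)
qed

text \<open>The generating function is a product of three geometric series; squaring the one in
  \<open>a\<close> produces the weights \<open>k + 1\<close>.\<close>

lemma p_poly_eq_sum:
  "p_poly n = (\<Sum>k\<le>n. of_nat (Suc k) * ([:1, 1:] ^ 2) ^ k * ([:-1, 1:] ^ 2) ^ (n - k))"
proof -
  define a b :: "int poly" where "a = [:1, 1:] ^ 2" and "b = [:-1, 1:] ^ 2"
  define A B where "A = Abs_fps (\<lambda>n. a ^ n)" and "B = Abs_fps (\<lambda>n. b ^ n)"
  have "gf_denom * (A * A * B) =
      ((1 - fps_const a * fps_X) * A) * ((1 - fps_const a * fps_X) * A) * ((1 - fps_const b * fps_X) * B)"
    by (simp add: gf_denom_def a_def b_def power2_eq_square mult_ac)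
  also have "\<dots> = 1" by (simp only: A_def B_def fps_geometric_mult mult_1)
  finally have gf: "gf = A * A * B" by (simp add: gf_unique)
  have "p_poly n = (\<Sum>k\<le>n. fps_nth (A * A) k * b ^ (n - k))"
    unfolding p_poly_def gf fps_mult_nth[of "A * A" B n] by (simp add: B_def atLeast0AtMost)
  moreover have "fps_nth (A * A) k = of_nat (Suc k) * a ^ k" for k
  proof -
    have "fps_nth (A * A) k = (\<Sum>i=0..k. a ^ k)"
      unfolding fps_mult_nth by (intro sum.cong) (simp_all add: A_def flip: power_add)
    thus ?thesis by simp
  qed
  ultimately show ?thesis by (simp only: a_def b_def)
qed

lemma weighted_geometric_sum:
  fixes a b :: "'a :: comm_ring_1"
  shows "(a - b) ^ 2 * (\<Sum>k\<le>n. of_nat (Suc k) * a ^ k * b ^ (n - k)) =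
    of_nat (n + 2) * a ^ (n + 1) * (a - b) - (a ^ (n + 2) - b ^ (n + 2))"
proof (induction n)
  case 0
  show ?case by (simp add: power2_eq_square algebra_simps)
next
  case (Suc n)
  define S where "S = (\<Sum>k\<le>n. of_nat (Suc k) * a ^ k * b ^ (n - k))"
  \<comment> \<open>Passing from \<open>n\<close> to \<open>Suc n\<close> multiplies the old sum by
    \<open>b\<close> and adds one new top term.\<close>
  have "(\<Sum>k\<le>n. of_nat (Suc k) * a ^ k * b ^ (Suc n - k)) = b * S"
    unfolding S_def sum_distrib_left by (intro sum.cong) (simp_all add: Suc_diff_le algebra_simps)
  hence "(\<Sum>k\<le>Suc n. of_nat (Suc k) * a ^ k * b ^ (Suc n - k)) = b * S + of_nat (n + 2) * a ^ (n + 1)"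
    by simp
  hence "(a - b) ^ 2 * (\<Sum>k\<le>Suc n. of_nat (Suc k) * a ^ k * b ^ (Suc n - k)) =
      b * ((a - b) ^ 2 * S) + of_nat (n + 2) * a ^ (n + 1) * (a - b) ^ 2"
    by (simp add: algebra_simps)
  also have "(a - b) ^ 2 * S = of_nat (n + 2) * a ^ (n + 1) * (a - b) - (a ^ (n + 2) - b ^ (n + 2))"
    using Suc.IH by (simp add: S_def)
  finally show ?case by (simp add: power2_eq_square algebra_simps)
qed

section \<open>Reduction modulo a prime\<close>

lemma prime_dvd_power_add_diff:
  fixes x y :: "'a :: comm_ring_1"
  assumes "prime p"
  shows "of_nat p dvd (x + y) ^ p - (x ^ p + y ^ p)"
proof -
  have p: "p > 0" using assms prime_gt_0_nat by blast
  have "(x + y) ^ p = (\<Sum>k\<le>p. of_nat (p choose k) * x ^ k * y ^ (p - k))"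
    by (rule binomial_ring)
  \<comment> \<open>Only the two outer binomial terms survive modulo \<open>p\<close>.\<close>
  also have "{..p} = insert 0 (insert p {0<..<p})" using p by auto
  also have "(\<Sum>k\<in>\<dots>. of_nat (p choose k) * x ^ k * y ^ (p - k)) =
      x ^ p + y ^ p + (\<Sum>k\<in>{0<..<p}. of_nat (p choose k) * x ^ k * y ^ (p - k))"
    using p by simp
  finally have "(x + y) ^ p - (x ^ p + y ^ p) = (\<Sum>k\<in>{0<..<p}. of_nat (p choose k) * x ^ k * y ^ (p - k))"
    by simp
  also have "of_nat p dvd \<dots>"
  proof (intro dvd_sum dvd_mult2)
    fix k assume "k \<in> {0<..<p}"
    hence "p dvd p choose k" using assms by (intro dvd_choose_prime) auto
    thus "(of_nat p :: 'a) dvd of_nat (p choose k)" by (metis dvd_def of_nat_mult)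
  qed
  finally show ?thesis .
qed

text \<open>Since \<open>a - b = 4 z\<close>, the closed form has left side \<open>16 z^2\<close>
  times the polynomial. For \<open>n + 2 = p\<close> its first term is divisible by
  \<open>p\<close>, and \<open>a^p - b^p\<close> is congruent to \<open>(a - b)^p\<close>.\<close>

lemma p_poly_mod_prime:
  assumes "prime p"
  shows "of_nat p dvd smult 16 ([:0, 1:] ^ 2 * p_poly (p - 2)) + smult (4 ^ p) (monom 1 p)"
proof -
  define a b :: "int poly" where "a = [:1, 1:] ^ 2" and "b = [:-1, 1:] ^ 2"
  have ab: "a - b = smult 4 [:0, 1:]" by (simp add: a_def b_def power2_eq_square)
  have p2: "p - 2 + 2 = p" using prime_ge_2_nat[OF assms] by simp
  have "smult 16 ([:0, 1:] ^ 2 * p_poly (p - 2)) = (a - b) ^ 2 * p_poly (p - 2)"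
    by (simp add: ab power2_eq_square)
  also have "\<dots> = of_nat p * a ^ (p - 2 + 1) * (a - b) - (a ^ p - b ^ p)"
    using weighted_geometric_sum[of a b "p - 2"] unfolding p2 by (simp add: p_poly_eq_sum a_def b_def)
  finally have "smult 16 ([:0, 1:] ^ 2 * p_poly (p - 2)) + (a - b) ^ p =
      of_nat p * (a ^ (p - 2 + 1) * (a - b)) - (((a - b) + b) ^ p - ((a - b) ^ p + b ^ p))"
    by simp
  also have "of_nat p dvd \<dots>"
    by (intro dvd_diff dvd_triv_left prime_dvd_power_add_diff assms)
  also have "(a - b) ^ p = smult (4 ^ p) (monom 1 p)"
    by (simp only: ab smult_power monom_altdef smult_1_left)
  finally show ?thesis .
qed

lemma prime_dvd_coeff_p_poly_iff:
  assumes p: "prime p" "odd p"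
  shows "int p dvd coeff (p_poly (p - 2)) k \<longleftrightarrow> k \<noteq> p - 2"
proof -
  have "p \<ge> 2" using p prime_ge_2_nat by blast
  \<comment> \<open>The shift by 2 compensates the factor \<open>z^2\<close>, so the monomial of
    degree \<open>p\<close> meets \<open>k = p - 2\<close>.\<close>
  have "int p dvd coeff (smult 16 ([:0, 1:] ^ 2 * p_poly (p - 2)) + smult (4 ^ p) (monom 1 p)) (k + 2)"
    using p_poly_mod_prime[OF p(1)] unfolding of_nat_poly const_poly_dvd_iff by blast
  moreover have "coeff ([:0, 1:] ^ 2 * p_poly (p - 2)) (k + 2) = coeff (p_poly (p - 2)) k"
    by (simp add: power2_eq_square)
  ultimately have dvd: "int p dvd 16 * coeff (p_poly (p - 2)) k + 4 ^ p * (if k = p - 2 then 1 else 0)"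
    using \<open>p \<ge> 2\<close> by (simp split: if_splits)
  \<comment> \<open>Oddness of \<open>p\<close> makes 16 and \<open>4 ^ p\<close> invertible modulo
    \<open>p\<close>.\<close>
  have cop: "coprime (int p) 2" using p by simp
  hence cop4: "coprime (int p) (4 ^ p)" "coprime (int p) 16"
    using coprime_power_right_iff[of "int p" 2 2] coprime_power_right_iff[of "int p" 2 4] by simp_all
  show ?thesis
  proof
    assume k: "int p dvd coeff (p_poly (p - 2)) k"
    show "k \<noteq> p - 2"
    proof
      assume "k = p - 2"
      with dvd k have "int p dvd 4 ^ p"
        by (simp add: dvd_add_right_iff)
      with cop4(1) have "is_unit (int p)"
        using coprime_absorb_left by blast
      thus False using \<open>p \<ge> 2\<close> by simp
    qed
  next
    assume "k \<noteq> p - 2"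
    with dvd cop4(2) show "int p dvd coeff (p_poly (p - 2)) k"
      by (simp add: coprime_dvd_mult_right_iff)
  qed
qed

section \<open>Degree, end coefficients and positivity\<close>

lemma degree_and_end_coeffs_p_poly:
  shows "degree (p_poly n) = 2 * n"
    and "2 * coeff (p_poly n) 0 = int ((n + 1) * (n + 2))"
    and "2 * coeff (p_poly n) (2 * n) = int ((n + 1) * (n + 2))"
proof -
  have sum: "2 * (\<Sum>k\<le>n. int (Suc k)) = int ((n + 1) * (n + 2))" by (induction n) auto
  \<comment> \<open>For \<open>k \<le> n\<close> each \<open>T k\<close> is monic of degree
    \<open>2 * n\<close> with constant term 1, so both end coefficients equal the sum of the
    weights.\<close>
  define T :: "nat \<Rightarrow> int poly" where "T k = ([:1, 1:] ^ 2) ^ k * ([:-1, 1:] ^ 2) ^ (n - k)" for k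
  have P: "p_poly n = (\<Sum>k\<le>n. smult (int (Suc k)) (T k))"
    unfolding p_poly_eq_sum T_def by (intro sum.cong) (simp_all add: of_nat_poly mult.assoc)
  have lcT: "lead_coeff (T k) = 1" for k
    by (simp add: T_def lead_coeff_mult lead_coeff_power)
  have degT: "degree (T k) = 2 * n" if "k \<le> n" for k
    using that by (simp add: T_def degree_mult_eq degree_power_eq)
  have "coeff (p_poly n) (2 * n) = (\<Sum>k\<le>n. int (Suc k))"
    unfolding P coeff_sum
  proof (intro sum.cong refl)
    fix k assume "k \<in> {..n}"
    thus "coeff (smult (int (Suc k)) (T k)) (2 * n) = int (Suc k)"
      using lcT[of k] degT[of k] by simp
  qed
  thus top: "2 * coeff (p_poly n) (2 * n) = int ((n + 1) * (n + 2))" by (simp only: sum)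
  have "coeff (p_poly n) 0 = (\<Sum>k\<le>n. int (Suc k))"
    unfolding P coeff_sum by (intro sum.cong) (simp_all add: T_def coeff_0_power coeff_mult_0)
  thus "2 * coeff (p_poly n) 0 = int ((n + 1) * (n + 2))" by (simp only: sum)
  show "degree (p_poly n) = 2 * n"
  proof (rule antisym)
    show "degree (p_poly n) \<le> 2 * n"
      unfolding P by (intro degree_sum_le) (auto simp: degT)
    show "2 * n \<le> degree (p_poly n)" 
    proof (rule le_degree)
      have "int ((n + 1) * (n + 2)) \<noteq> 0" by (simp only: of_nat_eq_0_iff) simp
      with top show "coeff (p_poly n) (2 * n) \<noteq> 0" by (metis mult_zero_right)
    qed
  qed
qed

lemma poly_p_poly_pos: "poly (map_poly real_of_int (p_poly n)) x > 0"
proof -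
  define t where "t k = real (Suc k) * ((x + 1) ^ 2) ^ k * ((x - 1) ^ 2) ^ (n - k)" for k
  have "poly (map_poly real_of_int (p_poly n)) x = (\<Sum>k\<le>n. t k)"
    unfolding p_poly_eq_sum map_poly_of_int_sum poly_sum t_def
    by (intro sum.cong)
      (simp_all add: map_poly_of_int_mult map_poly_of_int_smult map_poly_of_int_power map_poly_pCons
        of_nat_poly add_ac)
  also have "\<dots> > 0"
  \<comment> \<open>At \<open>x = -1\<close> the summand \<open>t 0\<close> has no factor
    \<open>x + 1\<close> and is positive; elsewhere \<open>t n\<close> has no factor
    \<open>x - 1\<close> and is positive.\<close>
  proof (cases "x = -1")
    case True
    hence "t 0 > 0" by (simp add: t_def)
    thus ?thesis by (intro sum_pos2[of _ 0]) (auto simp: t_def)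
  next
    case False
    hence "t n > 0" by (simp add: t_def)
    thus ?thesis by (intro sum_pos2[of _ n]) (auto simp: t_def)
  qed
  finally show ?thesis .
qed

theorem theorem6p1:
  fixes p n :: nat
  assumes "prime p" and "odd p" and "n = p - 2"
  shows "irreducible (map_poly rat_of_int (p_poly n))"
proof -
  have "p \<noteq> 2" using assms(2) by auto
  hence p: "p \<ge> 3" using prime_ge_2_nat[OF assms(1)] by simp
  have n: "n > 0" "odd n" using p assms by auto
  have q: "prime (int p)" using assms(1) by simp
  have deg: "degree (p_poly n) = 2 * n" by (rule degree_and_end_coeffs_p_poly)
  \<comment> \<open>Here \<open>2 * c = p * (p - 1)\<close>, so a second factor \<open>p\<close>
    would have to divide \<open>p - 1\<close>. This serves both end coefficients.\<close>
  have ends: "\<not> int p ^ 2 dvd c" if "2 * c = int ((n + 1) * (n + 2))" for c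
  proof
    assume "int p ^ 2 dvd c"
    hence "int p ^ 2 dvd 2 * c" by (rule dvd_mult)
    moreover have "(n + 1) * (n + 2) = p * (p - 1)"
      using p by (simp add: assms(3) Suc_diff_Suc numeral_2_eq_2)
    hence "2 * c = int p * int (p - 1)" by (simp only: that of_nat_mult)
    ultimately have "int p dvd int (p - 1)" using p by (simp add: power2_eq_square)
    thus False using p by (auto simp del: of_nat_diff dest: dvd_imp_le)
  qed
  have no_factor: False if FG: "p_poly n = F * G" "degree F > 0" "degree G > 0" for F G
  proof -
    have "degree F = n"
      using q prime_dvd_coeff_p_poly_iff[OF assms(1,2)] deg ends degree_and_end_coeffs_p_poly[of n] FG assms(3)
      by (intro degree_factor[of "int p" F G n]) (simp_all flip: FG(1))
    then obtain x where "poly (map_poly real_of_int F) x = 0"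
      using odd_degree_real_root[of "map_poly real_of_int F"] n by (auto simp: degree_map_poly_of_int)
    hence "poly (map_poly real_of_int (p_poly n)) x = 0"
      by (simp add: FG(1) map_poly_of_int_mult)
    thus False using poly_p_poly_pos[of n x] by simp
  qed
  have nz: "p_poly n \<noteq> 0" using deg n by auto
  show ?thesis
  proof (rule irreducibleI)
    show nz': "map_poly rat_of_int (p_poly n) \<noteq> 0"
      using nz map_poly_of_int_inject[of "p_poly n" 0, where 'a = rat] by simp
    show "\<not> is_unit (map_poly rat_of_int (p_poly n))"
      using deg n nz' by (simp add: is_unit_iff_degree degree_map_poly_of_int)
    fix f g assume fg: "map_poly rat_of_int (p_poly n) = f * g"
    \<comment> \<open>Over a field the nonzero constants are the units, so two nonunit factors would
      give integer factors of positive degree.\<close>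
    obtain F G where FG: "p_poly n = F * G" "degree F = degree f" "degree G = degree g"
      using int_poly_factor_of_rat_factor[OF fg nz] .
    have "f \<noteq> 0" "g \<noteq> 0" using fg nz' by auto
    thus "is_unit f \<or> is_unit g"
      using no_factor[of F G] FG by (auto simp: is_unit_iff_degree)
  qed
qed

end
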